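(* Let $X\subset\{0,1\}^{\mathbb{N}}$ be a nonempty binary shift space. Then the topological entropy $h(X)$ is positive if and only if there exists a set $J\subset\mathbb{N}$ which is an independence set for $X$, whose asymptotic density $d(J)$ exists, is positive, and is equal to its Shnirelman density, i.e. $d(J)=d_{\mathrm{Sh}}(J)>0$.
   Context: $\mathbb{N}=\{1,2,3,\dots\}$. A binary shift space is a set $X\subset\{0,1\}^{\mathbb{N}}$ (one-sided sequences $x=x_1x_2x_3\dots$) that is closed in the product topology and satisfies $\sigma(X)\subset X$, where $\sigma(x)_i=x_{i+1}$. $\mathcal{B}_n(X)$ is the set of all blocks of length $n$ occurring in some $x\in X$ (as $x_ix_{i+1}\dots x_{i+n-1}$ for some $i\ge 1$). The entropy of a nonempty shift space is $h(X)=\lim_{n\to\infty}\frac1n\log|\mathcal{B}_n(X)|=\inf_{n\ge1}\frac1n\log|\mathcal{B}_n(X)|$. A set $J\subset\mathbb{N}$ is an independence set for $X$ if for every function $\varphi\colon J\to\{0,1\}$ there is a point $x\in X$ with $x_i=\varphi(i)$ for every $i\in J$. For $A\subset\mathbb{N}$, the asymptotic density is $d(A)=\lim_{n\to\infty}\frac{|A\cap\{1,\dots,n\}|}{n}$ (when the limit exists), and the Shnirelman density is $d_{\mathrm{Sh}}(A)=\inf\left\{\frac{|A\cap\{1,\dots,n\}|}{n}:n\in\mathbb{N}\right\}$. *)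

theory Defs
  imports "HOL-Analysis.Analysis"
begin

text \<open>
  Sequences are indexed by the positive integers: a point of the full shift is a function on
  \<open>{1..}\<close> with values in \<open>{0, 1}\<close>, extended by \<^const>\<open>undefined\<close> at \<open>0\<close>.  The carrier of
  the topology below is accordingly \<open>{1..} \<rightarrow>\<^sub>E {0, 1}\<close>.
\<close>

definition full_shift :: "(nat \<Rightarrow> nat) topology" where
  "full_shift = product_topology (\<lambda>_. discrete_topology {0, 1}) {1..}"

definition shift :: "(nat \<Rightarrow> nat) \<Rightarrow> nat \<Rightarrow> nat" where
  "shift x = (\<lambda>i\<in>{1..}. x (i + 1))"

definition shift_space :: "(nat \<Rightarrow> nat) set \<Rightarrow> bool" where
  "shift_space X \<longleftrightarrow> closedin full_shift X \<and> shift ` X \<subseteq> X"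

definition blocks :: "nat \<Rightarrow> (nat \<Rightarrow> nat) set \<Rightarrow> nat list set" where
  "blocks n X = {map x [i..<i + n] | x i. x \<in> X \<and> i \<ge> 1}"

text \<open>For a nonempty shift space the limit exists, by subadditivity.\<close>

definition entropy :: "(nat \<Rightarrow> nat) set \<Rightarrow> real" where
  "entropy X = lim (\<lambda>n. ln (real (card (blocks n X))) / real n)"

definition independence_set :: "(nat \<Rightarrow> nat) set \<Rightarrow> nat set \<Rightarrow> bool" where
  "independence_set X J \<longleftrightarrow>
     J \<subseteq> {1..} \<and> (\<forall>\<phi> \<in> J \<rightarrow> {0, 1}. \<exists>x\<in>X. \<forall>i\<in>J. x i = \<phi> i)"

definition count_ratio :: "nat set \<Rightarrow> nat \<Rightarrow> real" where
  "count_ratio A n = real (card (A \<inter> {1..n})) / real n"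

text \<open>The value of \<open>asymptotic_density A\<close> is meaningful only if \<open>has_asymptotic_density A\<close>.\<close>

definition has_asymptotic_density :: "nat set \<Rightarrow> bool" where
  "has_asymptotic_density A \<longleftrightarrow> convergent (count_ratio A)"

definition asymptotic_density :: "nat set \<Rightarrow> real" where
  "asymptotic_density A = lim (count_ratio A)"

definition shnirelman_density :: "nat set \<Rightarrow> real" where
  "shnirelman_density A = (INF n\<in>{1..}. count_ratio A n)"

end

theory Submission
  imports Defs
begin

text \<open>
  Positive entropy makes the number of prefixes of length \<open>n\<close> exponential in \<open>n\<close>, so by the
  Sauer--Shelah lemma the maximal size \<open>s n\<close> of an independence set in \<open>{1..n}\<close> is at least linear.
  Independence sets are stable under subsets and left shifts, so \<open>s\<close> is subadditive and \<open>s n / n\<close>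
  converges to its infimum \<open>d > 0\<close>.  For each \<open>N\<close> some independence set has at least \<open>d * n\<close>
  elements in \<open>{1..n}\<close> for all \<open>n \<le> N\<close>, and by compactness a single \<open>J\<close> does so for all \<open>n\<close>; since
  \<open>J\<close> has at most \<open>s n\<close> elements in \<open>{1..n}\<close>, both of its densities equal \<open>d\<close>.  Conversely, an
  independence set with Shnirelman density \<open>d\<close> forces at least \<open>2 powr (d * n)\<close> prefixes.
\<close>

section \<open>Subadditive sequences\<close>

lemma subadditive_mult_le:
  fixes u :: "nat \<Rightarrow> real"
  assumes sub: "\<And>m n. u (m + n) \<le> u m + u n"
  shows "u (q * m + r) \<le> real q * u m + u r"
proof (induction q)
  case (Suc q)
  have "u (Suc q * m + r) = u (m + (q * m + r))" by (simp add: add.assoc)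
  also have "\<dots> \<le> u m + u (q * m + r)" by (rule sub)
  finally show ?case using Suc by (simp add: algebra_simps)
qed simp

text \<open>Fekete's lemma. Write \<open>n\<close> as a multiple of a near-optimal \<open>m\<close>
  plus a remainder; the remainder costs at most a constant, which vanishes after division by
  \<open>n\<close>.\<close>

theorem fekete:
  fixes u :: "nat \<Rightarrow> real"
  assumes sub: "\<And>m n. u (m + n) \<le> u m + u n" and nonneg: "\<And>n. 0 \<le> u n"
  shows "(\<lambda>n. u n / n) \<longlonglongrightarrow> (INF n\<in>{1..}. u n / n)"
proof -
  define L where "L = (INF n\<in>{1..}. u n / n)"
  have bdd: "bdd_below ((\<lambda>n. u n / real n) ` {1..})"
    using nonneg by (intro bdd_belowI2[where m = 0]) auto
  have lower: "L \<le> u n / n" if "n \<ge> 1" for n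
    unfolding L_def using that by (intro cINF_lower[OF bdd]) auto
  show ?thesis
    unfolding L_def[symmetric]
  proof (rule LIMSEQ_I)
    fix e :: real assume "e > 0"
    then have "\<exists>m\<in>{1..}. u m / real m < L + e / 2"
      by (subst cINF_less_iff[OF _ bdd, symmetric]) (auto simp: L_def)
    then obtain m where m: "m \<ge> 1" "u m / real m < L + e / 2" by auto
    \<comment> \<open>Since \<open>u\<close> is nonnegative, this sum dominates \<open>u r\<close>
      for every possible remainder \<open>r\<close>.\<close>
    define C where "C = (\<Sum>r<m. u r)"
    have C: "u r \<le> C" if "r < m" for r
      unfolding C_def using that nonneg by (intro member_le_sum) auto
    have "C \<ge> 0" unfolding C_def using nonneg by (intro sum_nonneg)
    obtain N :: nat where N: "real N > C / (e / 2)" using reals_Archimedean2 by blast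
    show "\<exists>no. \<forall>n\<ge>no. norm (u n / real n - L) < e"
    proof (intro exI[of _ "Suc N"] allI impI)
      fix n assume n: "n \<ge> Suc N"
      then have "real n > C / (e / 2)" using N by linarith
      then have Cn: "C / n < e / 2" using n \<open>e > 0\<close> by (simp add: field_simps)
      have "u n = u (n div m * m + n mod m)" by simp
      also have "\<dots> \<le> real (n div m) * u m + u (n mod m)"
        by (rule subadditive_mult_le[OF sub])
      also have "\<dots> \<le> real n / real m * u m + C"
        using m by (intro add_mono mult_right_mono C nonneg) (auto simp: of_nat_div_le_of_nat)
      finally have "u n / n \<le> (real n / real m * u m + C) / n"
        by (rule divide_right_mono) simp
      also have "\<dots> = u m / m + C / n" using n m by (simp add: field_simps)
      also have "\<dots> < L + e" using m Cn by linarith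
      finally have "u n / n < L + e" .
      moreover have "L \<le> u n / n" using n by (intro lower) simp
      ultimately show "norm (u n / real n - L) < e" by simp
    qed
  qed
qed

lemma fekete_le:
  fixes u :: "nat \<Rightarrow> real"
  assumes "\<And>n. 0 \<le> u n" and "n \<ge> 1"
  shows "(INF n\<in>{1..}. u n / n) \<le> u n / n"
  using assms by (intro cINF_lower bdd_belowI2[where m = 0]) auto

section \<open>Shattering\<close>

definition shatters :: "'a set set \<Rightarrow> 'a set \<Rightarrow> bool" where
  "shatters F A \<longleftrightarrow> (\<lambda>B. B \<inter> A) ` F = Pow A"

lemma shatters_alt: "shatters F A \<longleftrightarrow> (\<forall>C\<subseteq>A. \<exists>B\<in>F. B \<inter> A = C)"
proof -
  have "(\<lambda>B. B \<inter> A) ` F \<subseteq> Pow A" by auto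
  then have "shatters F A \<longleftrightarrow> Pow A \<subseteq> (\<lambda>B. B \<inter> A) ` F"
    unfolding shatters_def by (auto intro: equalityI)
  then show ?thesis by (simp only: subset_iff Pow_iff image_iff Bex_def eq_commute)
qed

lemma shattersI: "(\<And>C. C \<subseteq> A \<Longrightarrow> \<exists>B\<in>F. B \<inter> A = C) \<Longrightarrow> shatters F A"
  by (simp add: shatters_alt)

lemma shattersE:
  assumes "shatters F A" "C \<subseteq> A"
  obtains B where "B \<in> F" "B \<inter> A = C"
  using assms unfolding shatters_alt by metis

lemma shatters_mono: "shatters F A \<Longrightarrow> F \<subseteq> G \<Longrightarrow> shatters G A"
  unfolding shatters_alt by (meson subsetD)

lemma two_power_le_card_if_shatters:
  assumes "shatters F A" "finite F" "finite A"
  shows "2 ^ card A \<le> card F"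
  using assms card_image_le[of F "\<lambda>B. B \<inter> A"] by (simp add: shatters_def card_Pow)

text \<open>Pajor's form of the Sauer--Shelah lemma.\<close>

theorem card_le_card_shattered:
  assumes "finite U" "F \<subseteq> Pow U"
  shows "card F \<le> card {A. A \<subseteq> U \<and> shatters F A}"
  using assms
proof (induction U arbitrary: F rule: finite_induct)
  case empty
  then have "F = {} \<or> F = {{}}" by auto
  then show ?case
  proof
    assume "F = {{}}"
    then have "{A. A \<subseteq> {} \<and> shatters F A} = {{}}" by (auto simp: shatters_def)
    then show ?thesis using \<open>F = {{}}\<close> by simp
  qed simp
next
  case (insert u U)
  \<comment> \<open>Both families live on \<open>U\<close>: \<open>F0\<close> holds the members
    avoiding \<open>u\<close>, and \<open>F1\<close> those containing \<open>u\<close>, with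
    \<open>u\<close> deleted.\<close>
  define F0 where "F0 = {B \<in> F. u \<notin> B}"
  define F1 where "F1 = {B. u \<notin> B \<and> insert u B \<in> F}"
  define sh where "sh = (\<lambda>F. {A. A \<subseteq> U \<and> shatters F A})"
  have fin: "finite F" using insert by (meson finite_Pow_iff finite_insert finite_subset)
  have fin_sh: "finite (sh G)" for G unfolding sh_def using insert by simp
  have "F = F0 \<union> insert u ` F1"
  proof (intro equalityI subsetI)
    fix B assume "B \<in> F"
    show "B \<in> F0 \<union> insert u ` F1"
    proof (cases "u \<in> B")
      case True
      then have "B - {u} \<in> F1" using \<open>B \<in> F\<close> by (simp add: F1_def insert_absorb)
      then have "insert u (B - {u}) \<in> insert u ` F1" by (rule imageI)
      then show ?thesis using True by (simp add: insert_absorb)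
    qed (use \<open>B \<in> F\<close> in \<open>auto simp: F0_def\<close>)
  qed (auto simp: F0_def F1_def)
  moreover have "inj_on (insert u) F1" by (auto simp: inj_on_def F1_def)
  moreover have "card (F0 \<union> insert u ` F1) \<le> card F0 + card (insert u ` F1)"
    by (rule card_Un_le)
  ultimately have "card F \<le> card F0 + card F1" by (simp add: card_image)
  moreover have "card F0 \<le> card (sh F0)" "card F1 \<le> card (sh F1)"
    unfolding sh_def using insert.prems
    by (intro insert.IH; auto simp: F0_def F1_def)+
  \<comment> \<open>A set shattered by both families is counted twice; the second count is paid for
    by the same set with \<open>u\<close> added.\<close>
  moreover have "card (sh F0) + card (sh F1) = card (sh F0 \<union> sh F1) + card (sh F0 \<inter> sh F1)"
    by (rule card_Un_Int[OF fin_sh fin_sh])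
  moreover have "card (insert u ` (sh F0 \<inter> sh F1)) = card (sh F0 \<inter> sh F1)"
    using insert.hyps by (intro card_image) (auto simp: inj_on_def sh_def)
  moreover have "card ((sh F0 \<union> sh F1) \<union> insert u ` (sh F0 \<inter> sh F1))
      = card (sh F0 \<union> sh F1) + card (insert u ` (sh F0 \<inter> sh F1))"
    using insert.hyps fin_sh by (intro card_Un_disjoint) (auto simp: sh_def)
  moreover have "card ((sh F0 \<union> sh F1) \<union> insert u ` (sh F0 \<inter> sh F1))
      \<le> card {A. A \<subseteq> insert u U \<and> shatters F A}"
  proof (rule card_mono)
    show "(sh F0 \<union> sh F1) \<union> insert u ` (sh F0 \<inter> sh F1)
          \<subseteq> {A. A \<subseteq> insert u U \<and> shatters F A}"
    proof
      fix A assume "A \<in> (sh F0 \<union> sh F1) \<union> insert u ` (sh F0 \<inter> sh F1)"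
      then consider "A \<in> sh F0" | "A \<in> sh F1"
        | A' where "A = insert u A'" "A' \<in> sh F0" "A' \<in> sh F1" by auto
      then show "A \<in> {A. A \<subseteq> insert u U \<and> shatters F A}"
      proof cases
        case 1
        then have "shatters F A" using shatters_mono[of F0 A F] by (auto simp: sh_def F0_def)
        then show ?thesis using 1 by (auto simp: sh_def)
      next
        case 2
        then have A: "A \<subseteq> U" "shatters F1 A" by (simp_all add: sh_def)
        have "shatters F A"
        proof (rule shattersI)
          fix C assume "C \<subseteq> A"
          obtain B where B: "B \<in> F1" "B \<inter> A = C"
            using A(2) \<open>C \<subseteq> A\<close> by (rule shattersE)
          \<comment> \<open>Putting \<open>u\<close> back leaves the trace unchanged because
            \<open>u\<close> lies outside \<open>A\<close>.\<close>
          have "insert u B \<inter> A = C" using B(2) A(1) insert.hyps by auto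
          then show "\<exists>B\<in>F. B \<inter> A = C" using B(1) by (auto simp: F1_def)
        qed
        then show ?thesis using A(1) by auto
      next
        case 3
        then have A': "A' \<subseteq> U" "shatters F0 A'" "shatters F1 A'" by (simp_all add: sh_def)
        have "shatters F A"
        proof (rule shattersI)
          fix C assume C: "C \<subseteq> A"
          then have "C - {u} \<subseteq> A'" using 3(1) by auto
          \<comment> \<open>Whether \<open>C\<close> contains \<open>u\<close> decides which of the
            two families supplies the witness.\<close>
          show "\<exists>B\<in>F. B \<inter> A = C"
          proof (cases "u \<in> C")
            case True
            obtain B where B: "B \<in> F1" "B \<inter> A' = C - {u}"
              using A'(3) \<open>C - {u} \<subseteq> A'\<close> by (rule shattersE)
            have "insert u B \<inter> A = C" using B(2) True 3(1) by auto
            then show ?thesis using B(1) by (auto simp: F1_def)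
          next
            case False
            obtain B where B: "B \<in> F0" "B \<inter> A' = C - {u}"
              using A'(2) \<open>C - {u} \<subseteq> A'\<close> by (rule shattersE)
            have "u \<notin> B" using B(1) by (simp add: F0_def)
            then have "B \<inter> A = C" using B(2) False 3(1) by auto
            then show ?thesis using B(1) by (auto simp: F0_def)
          qed
        qed
        then show ?thesis using A'(1) 3(1) by auto
      qed
    qed
  qed (use insert.hyps in simp)
  ultimately show ?case by linarith
qed

section \<open>Counting small subsets by weights\<close>

lemma sum_Pow_power_card:
  fixes t :: real
  assumes "finite U"
  shows "(\<Sum>A\<in>Pow U. t ^ card A) = (1 + t) ^ card U"
  using prod_add[OF assms, of "\<lambda>_. t" "\<lambda>_. 1"] by (simp add: add.commute)

text \<open>Give each set the weight \<open>t ^ card A\<close>. As \<open>t <= 1\<close>, sets with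
  at most \<open>m\<close> elements weigh at least \<open>t ^ m\<close>, and \<open>Pow U\<close>
  weighs \<open>(1 + t) ^ card U\<close>. This replaces estimates of binomial sums.\<close>

lemma card_small_subsets_le:
  fixes t :: real
  assumes "finite U" "0 < t" "t \<le> 1" "S \<subseteq> Pow U" "\<And>A. A \<in> S \<Longrightarrow> card A \<le> m"
  shows "real (card S) * t ^ m \<le> (1 + t) ^ card U"
proof -
  have "real (card S) * t ^ m = (\<Sum>A\<in>S. t ^ m)" by simp
  also have "\<dots> \<le> (\<Sum>A\<in>S. t ^ card A)"
    using assms by (intro sum_mono power_decreasing) auto
  also have "\<dots> \<le> (\<Sum>A\<in>Pow U. t ^ card A)"
    using assms by (intro sum_mono2) auto
  finally show ?thesis using sum_Pow_power_card[OF assms(1)] by simp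
qed

section \<open>Compactness\<close>

text \<open>A Koenig-type argument: coordinates are fixed one at a time by pigeonhole, always
  keeping infinitely many indices. It serves both points of \<open>X\<close> and indicator functions
  of independence sets.\<close>

lemma finite_valued_cluster_point:
  fixes f :: "nat \<Rightarrow> nat \<Rightarrow> 'a"
  assumes fin: "\<And>i. finite (B i)" and range: "\<And>n i. f n i \<in> B i"
  obtains y where "\<And>N. \<exists>n\<ge>N. \<forall>i\<le>N. f n i = y i"
proof -
  define P where "P = (\<lambda>k g. infinite {n. \<forall>i<k. f n i = g i})"
  have step: "\<exists>h. P (Suc k) h \<and> (\<forall>i<k. h i = g i)" if "P k g" for k g
  proof -
    have "\<exists>b\<in>B k. infinite {n \<in> {n. \<forall>i<k. f n i = g i}. f n k = b}"
      using that range fin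
      by (intro pigeonhole_infinite_rel[where R = "\<lambda>n b. f n k = b"]) (auto simp: P_def)
    then obtain b where b: "infinite {n \<in> {n. \<forall>i<k. f n i = g i}. f n k = b}" by auto
    have "{n \<in> {n. \<forall>i<k. f n i = g i}. f n k = b} = {n. \<forall>i<Suc k. f n i = (g(k := b)) i}"
      by (auto simp: less_Suc_eq)
    then show ?thesis using b by (intro exI[of _ "g(k := b)"]) (auto simp: P_def)
  qed
  have "\<exists>g. \<forall>k. P k (g k) \<and> (\<forall>i<k. g (Suc k) i = g k i)"
    by (rule dependent_nat_choice) (use step in \<open>auto simp: P_def\<close>)
  then obtain g where g: "\<And>k. P k (g k)" "\<And>k i. i < k \<Longrightarrow> g (Suc k) i = g k i" by blast
  \<comment> \<open>Later stages preserve earlier coordinates, so the diagonal agrees with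
    \<open>g k\<close> below \<open>k\<close>.\<close>
  define y where "y = (\<lambda>i. g (Suc i) i)"
  have gy: "g k i = y i" if "i < k" for k i
    using that
  proof (induction k)
    case (Suc k)
    then show ?case using g(2)[of i k] by (cases "i = k") (auto simp: y_def)
  qed simp
  have "\<exists>n\<ge>N. \<forall>i\<le>N. f n i = y i" for N
  proof -
    have "\<exists>n\<ge>N. n \<in> {n. \<forall>i<Suc N. f n i = g (Suc N) i}"
      using g(1)[of "Suc N"] by (auto simp: P_def infinite_nat_iff_unbounded_le)
    then show ?thesis by (auto simp: gy)
  qed
  then show ?thesis using that by blast
qed

lemma topspace_full_shift: "topspace full_shift = {1..} \<rightarrow>\<^sub>E {0, 1}"
  by (simp add: full_shift_def)

text \<open>A basic neighbourhood constrains only finitely many coordinates, so agreement on long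
  initial segments is enough to enter it.\<close>

lemma closedin_full_shiftD:
  assumes closed: "closedin full_shift X" and y: "y \<in> {1..} \<rightarrow>\<^sub>E {0, 1}"
    and approx: "\<And>N. \<exists>x\<in>X. \<forall>i\<le>N. x i = y i"
  shows "y \<in> X"
proof (rule ccontr)
  assume "y \<notin> X"
  define S where "S = topspace full_shift - X"
  have yS: "y \<in> S" using \<open>y \<notin> X\<close> y by (simp add: S_def topspace_full_shift)
  have "openin (product_topology (\<lambda>_. discrete_topology {0, 1}) {1..}) S"
    using closed by (simp add: closedin_def S_def full_shift_def)
  from bspec[OF this[unfolded openin_product_topology_alt topspace_discrete_topology] yS]
  obtain U where U: "finite {i \<in> {1..}. U i \<noteq> {0, 1}}" "y \<in> Pi\<^sub>E {1..} U" "Pi\<^sub>E {1..} U \<subseteq> S"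
    by (elim exE conjE) (rule that)
  obtain N where N: "\<And>i. i \<in> {i \<in> {1..}. U i \<noteq> {0, 1}} \<Longrightarrow> i \<le> N"
    using U(1) finite_nat_set_iff_bounded_le by auto
  obtain x where x: "x \<in> X" "\<And>i. i \<le> N \<Longrightarrow> x i = y i" using approx by blast
  have x01: "x \<in> {1..} \<rightarrow>\<^sub>E {0, 1}"
    using closedin_subset[OF closed] x(1) unfolding topspace_full_shift by (rule subsetD)
  have "x i \<in> U i" if "i \<ge> 1" for i
  proof (cases "U i = {0, 1}")
    case True
    then show ?thesis using PiE_mem[OF x01, of i] that by simp
  next
    case False
    then have "i \<le> N" using that by (intro N) simp
    then show ?thesis using x(2)[of i] PiE_mem[OF U(2), of i] that by simp
  qed
  then have "x \<in> Pi\<^sub>E {1..} U" using x01 by (auto simp: PiE_iff)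
  then show False using U(3) x(1) by (auto simp: S_def)
qed

section \<open>Blocks and entropy\<close>

lemma shift_space_value:
  assumes "shift_space X" "x \<in> X" "i \<ge> 1"
  shows "x i \<in> {0, 1}"
  using assms closedin_subset[of full_shift X] PiE_mem[of x "{1..}" "\<lambda>_. {0, 1}" i]
  by (auto simp: shift_space_def topspace_full_shift)

lemma shift_space_undefined:
  assumes "shift_space X" "x \<in> X"
  shows "x 0 = undefined"
  using assms closedin_subset[of full_shift X] PiE_arb[of x "{1..}" "\<lambda>_. {0, 1}" 0]
  by (auto simp: shift_space_def topspace_full_shift)

lemma funpow_shift_mem:
  assumes "shift_space X" "x \<in> X"
  shows "(shift ^^ k) x \<in> X"
  using assms by (induction k) (auto simp: shift_space_def)

lemma funpow_shift_apply: "i \<ge> 1 \<Longrightarrow> (shift ^^ k) x i = x (i + k)"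
  by (induction k arbitrary: i) (auto simp: shift_def)

text \<open>Shift invariance moves a block at position \<open>i\<close> to the front by
  \<open>i - 1\<close> shifts, positions being counted from 1.\<close>

lemma blocks_eq_prefixes:
  assumes "shift_space X"
  shows "blocks n X = (\<lambda>x. map x [1..<Suc n]) ` X"
proof (intro equalityI subsetI)
  fix w assume "w \<in> blocks n X"
  then obtain x i where xi: "x \<in> X" "i \<ge> 1" "w = map x [i..<i + n]" by (auto simp: blocks_def)
  obtain k where "i = Suc k" using xi(2) by (cases i) auto
  then have "w = map ((shift ^^ k) x) [1..<Suc n]"
    using xi by (intro nth_equalityI) (auto simp: funpow_shift_apply add_ac simp del: upt_Suc)
  then show "w \<in> (\<lambda>x. map x [1..<Suc n]) ` X"
    using funpow_shift_mem[OF assms xi(1)] by blast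
next
  fix w assume "w \<in> (\<lambda>x. map x [1..<Suc n]) ` X"
  then obtain x where "x \<in> X" "w = map x [1..<Suc n]" by blast
  then show "w \<in> blocks n X" unfolding blocks_def by (auto intro!: exI[of _ x] exI[of _ "1::nat"])
qed

lemma finite_blocks:
  assumes "shift_space X"
  shows "finite (blocks n X)"
proof (rule finite_subset)
  show "blocks n X \<subseteq> {w. set w \<subseteq> {0, 1} \<and> length w = n}"
  proof
    fix w assume "w \<in> blocks n X"
    then obtain x i where xi: "x \<in> X" "i \<ge> 1" "w = map x [i..<i + n]" by (auto simp: blocks_def)
    have "x ` {i..<i + n} \<subseteq> {0, 1}"
      using xi(2) by (intro image_subsetI shift_space_value[OF assms xi(1)]) simp
    then show "w \<in> {w. set w \<subseteq> {0, 1} \<and> length w = n}" using xi(3) by simp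
  qed
qed (rule finite_lists_length_eq, simp)

lemma card_blocks_pos:
  assumes "shift_space X" "X \<noteq> {}"
  shows "card (blocks n X) > 0"
  using assms finite_blocks[OF assms(1)] by (auto simp: card_gt_0_iff blocks_eq_prefixes)

lemma card_blocks_add_le:
  assumes "shift_space X"
  shows "card (blocks (m + n) X) \<le> card (blocks m X) * card (blocks n X)"
proof -
  have "blocks (m + n) X \<subseteq> (\<lambda>(v, w). v @ w) ` (blocks m X \<times> blocks n X)"
  proof
    fix b assume "b \<in> blocks (m + n) X"
    then obtain x i where xi: "x \<in> X" "i \<ge> 1" "b = map x [i..<i + (m + n)]"
      by (auto simp: blocks_def)
    have "b = map x [i..<i + m] @ map x [i + m..<(i + m) + n]"
      using upt_add_eq_append[of i "i + m" n] xi by (simp add: add.assoc)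
    moreover have "map x [i..<i + m] \<in> blocks m X" "map x [i + m..<(i + m) + n] \<in> blocks n X"
      using xi unfolding blocks_def by (blast, force)
    ultimately show "b \<in> (\<lambda>(v, w). v @ w) ` (blocks m X \<times> blocks n X)" by auto
  qed
  then have "card (blocks (m + n) X) \<le> card (blocks m X \<times> blocks n X)"
    using finite_blocks[OF assms] by (meson finite_SigmaI surj_card_le)
  then show ?thesis by (simp add: card_cartesian_product)
qed

text \<open>Cutting a block in two makes the logarithm of the block count subadditive, so Fekete's
  lemma yields both the limit and its description as an infimum.\<close>

lemma
  assumes "shift_space X" "X \<noteq> {}"
  shows entropy_tendsto: "(\<lambda>n. ln (real (card (blocks n X))) / n) \<longlonglongrightarrow> entropy X"
    and entropy_le: "n \<ge> 1 \<Longrightarrow> entropy X \<le> ln (real (card (blocks n X))) / n"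
proof -
  define u where "u = (\<lambda>n. ln (real (card (blocks n X))))"
  have "u (m + n) \<le> u m + u n" for m n
  proof -
    have "ln (real (card (blocks (m + n) X))) \<le> ln (real (card (blocks m X) * card (blocks n X)))"
      using card_blocks_pos[OF assms, of "m + n"] card_blocks_add_le[OF assms(1), of m n]
      by (subst ln_le_cancel_iff) (auto simp flip: of_nat_mult simp: card_blocks_pos[OF assms])
    then show ?thesis
      using card_blocks_pos[OF assms] by (simp add: u_def ln_mult)
  qed
  moreover have nonneg: "0 \<le> u n" for n
    using card_blocks_pos[OF assms, of n] by (simp add: u_def Suc_leI)
  ultimately have lim: "(\<lambda>n. u n / n) \<longlonglongrightarrow> (INF n\<in>{1..}. u n / n)" by (rule fekete)
  then have "entropy X = (INF n\<in>{1..}. u n / n)"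
    unfolding entropy_def u_def by (rule limI)
  then show "(\<lambda>n. ln (real (card (blocks n X))) / n) \<longlonglongrightarrow> entropy X"
    and "n \<ge> 1 \<Longrightarrow> entropy X \<le> ln (real (card (blocks n X))) / n"
    using lim fekete_le[OF nonneg] by (simp_all add: u_def)
qed

text \<open>Prefixes are recorded as their sets of positions of 1, the form in which shattering
  applies to them.\<close>

definition traces :: "nat \<Rightarrow> (nat \<Rightarrow> nat) set \<Rightarrow> nat set set" where
  "traces n X = (\<lambda>x. {i \<in> {1..n}. x i = 1}) ` X"

lemma card_traces:
  assumes "shift_space X"
  shows "card (traces n X) = card (blocks n X)"
proof -
  \<comment> \<open>\<open>g\<close> turns a set back into its indicator word, which determines any
    subset of \<open>{1..n}\<close>.\<close>
  define g where "g = (\<lambda>S. map (\<lambda>i. if i \<in> S then 1 else 0 :: nat) [1..<Suc n])"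
  have g: "g {i \<in> {1..n}. x i = 1} = map x [1..<Suc n]" if "x \<in> X" for x
    using shift_space_value[OF assms that] by (auto simp: g_def)
  have "g ` traces n X = blocks n X"
    unfolding traces_def blocks_eq_prefixes[OF assms] image_image
    by (rule image_cong[OF refl g])
  moreover have "inj_on g (Pow {1..n})"
    by (fastforce simp: inj_on_def g_def map_eq_conv split: if_splits)
  then have "inj_on g (traces n X)" by (rule inj_on_subset) (auto simp: traces_def)
  ultimately show ?thesis using card_image by fastforce
qed

section \<open>Independence sets\<close>

lemma independence_setD:
  assumes "independence_set X J" "\<phi> \<in> J \<rightarrow> {0, 1}"
  obtains x where "x \<in> X" "\<And>i. i \<in> J \<Longrightarrow> x i = \<phi> i"
  using assms unfolding independence_set_def by metis

lemma independence_set_empty: "X \<noteq> {} \<Longrightarrow> independence_set X {}"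
  by (auto simp: independence_set_def)

lemma independence_set_subset:
  assumes "independence_set X J" "K \<subseteq> J"
  shows "independence_set X K"
  unfolding independence_set_def
proof (intro conjI ballI)
  show "K \<subseteq> {1..}" using assms by (auto simp: independence_set_def)
  fix \<phi> :: "nat \<Rightarrow> nat" assume "\<phi> \<in> K \<rightarrow> {0, 1}"
  \<comment> \<open>The prescription is extended to \<open>J\<close> by the default value 0.\<close>
  then have "(\<lambda>i. if i \<in> K then \<phi> i else 0) \<in> J \<rightarrow> {0, 1}" by (simp add: Pi_iff)
  from independence_setD[OF assms(1) this]
  obtain x where "x \<in> X" "\<And>i. i \<in> J \<Longrightarrow> x i = (if i \<in> K then \<phi> i else 0)" by blast
  then show "\<exists>x\<in>X. \<forall>i\<in>K. x i = \<phi> i" using assms(2) by (intro bexI[of _ x]) auto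
qed

lemma independence_set_shift:
  assumes "shift_space X" "independence_set X J"
  shows "independence_set X {i. i \<ge> 1 \<and> i + k \<in> J}"
  unfolding independence_set_def
proof (intro conjI ballI)
  fix \<phi> :: "nat \<Rightarrow> nat" assume \<phi>: "\<phi> \<in> {i. i \<ge> 1 \<and> i + k \<in> J} \<rightarrow> {0, 1}"
  \<comment> \<open>Coordinate \<open>i\<close> after \<open>k\<close> shifts is coordinate
    \<open>i + k\<close> before them; coordinates up to \<open>k\<close> get the default 0.\<close>
  have "(\<lambda>j. if j > k then \<phi> (j - k) else 0) \<in> J \<rightarrow> {0, 1}"
  proof (rule Pi_I)
    fix j assume "j \<in> J"
    then show "(if j > k then \<phi> (j - k) else 0) \<in> {0, 1}"
      using Pi_mem[OF \<phi>, of "j - k"] by simp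
  qed
  from independence_setD[OF assms(2) this]
  obtain x where x: "x \<in> X" "\<And>j. j \<in> J \<Longrightarrow> x j = (if j > k then \<phi> (j - k) else 0)" by blast
  then show "\<exists>x\<in>X. \<forall>i\<in>{i. i \<ge> 1 \<and> i + k \<in> J}. x i = \<phi> i"
    using funpow_shift_mem[OF assms(1) x(1), of k]
    by (intro bexI[of _ "(shift ^^ k) x"]) (auto simp: funpow_shift_apply)
qed auto

text \<open>Compactness: points realising the prescription on longer and longer initial segments
  have a cluster point, which lies in the closed set \<open>X\<close>.\<close>

lemma independence_set_if_initial_segments:
  assumes X: "shift_space X" and "J \<subseteq> {1..}"
    and ind: "\<And>N. independence_set X (J \<inter> {1..N})"
  shows "independence_set X J"
  unfolding independence_set_def
proof (intro conjI ballI assms)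
  fix \<phi> :: "nat \<Rightarrow> nat" assume \<phi>: "\<phi> \<in> J \<rightarrow> {0, 1}"
  have "\<exists>x\<in>X. \<forall>i\<in>J \<inter> {1..N}. x i = \<phi> i" for N
  proof -
    have "\<phi> \<in> J \<inter> {1..N} \<rightarrow> {0, 1}" by (intro Pi_I Pi_mem[OF \<phi>]) auto
    then show ?thesis using ind[of N] unfolding independence_set_def by blast
  qed
  then obtain f where f: "\<And>N. f N \<in> X" "\<And>N i. i \<in> J \<inter> {1..N} \<Longrightarrow> f N i = \<phi> i" by metis
  \<comment> \<open>Coordinate 0 is always \<open>undefined\<close>, so its range is treated
    separately.\<close>
  have range: "f n i \<in> (if i = 0 then {undefined} else {0, 1})" for n i
    using shift_space_value[OF X f(1), of i n] shift_space_undefined[OF X f(1)] by auto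
  have "\<And>i. finite (if i = 0 then {undefined} else {0, 1 :: nat})" by simp
  from finite_valued_cluster_point[of "\<lambda>i. if i = 0 then {undefined} else {0, 1}" f, OF this range]
  obtain y where y: "\<And>N. \<exists>n\<ge>N. \<forall>i\<le>N. f n i = y i" by blast
  have y_range: "y i \<in> (if i = 0 then {undefined} else {0, 1})" for i
    using y[of i] range[of _ i] by (metis order_refl)
  have "y \<in> X"
  proof (rule closedin_full_shiftD)
    show "closedin full_shift X" using X by (simp add: shift_space_def)
    show "y \<in> {1..} \<rightarrow>\<^sub>E {0, 1}"
    proof (rule PiE_I)
      fix i :: nat assume "i \<in> {1..}"
      then show "y i \<in> {0, 1}" using y_range[of i] by simp
    next
      fix i :: nat assume "i \<notin> {1..}"
      then show "y i = undefined" using y_range[of i] by simp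
    qed
    show "\<exists>x\<in>X. \<forall>i\<le>N. x i = y i" for N using y[of N] f(1) by blast
  qed
  moreover have "y i = \<phi> i" if "i \<in> J" for i
  proof -
    obtain n where "n \<ge> i" "f n i = y i" using y[of i] by blast
    then show ?thesis using f(2)[of i n] that assms(2) by auto
  qed
  ultimately show "\<exists>x\<in>X. \<forall>i\<in>J. x i = \<phi> i" by blast
qed

text \<open>Subsets of \<open>A\<close> correspond to 0-1 functions on \<open>A\<close>. Through
  this bridge the Sauer-Shelah lemma produces independence sets.\<close>

lemma shatters_traces_iff:
  assumes X: "shift_space X" and "A \<subseteq> {1..n}"
  shows "shatters (traces n X) A \<longleftrightarrow> independence_set X A"
proof
  assume sh: "shatters (traces n X) A"
  show "independence_set X A" unfolding independence_set_def
  proof (intro conjI ballI)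
    show "A \<subseteq> {1..}" using assms(2) by auto
    fix \<phi> :: "nat \<Rightarrow> nat" assume \<phi>: "\<phi> \<in> A \<rightarrow> {0, 1}"
    have "{i \<in> A. \<phi> i = 1} \<subseteq> A" by blast
    then obtain B where B: "B \<in> traces n X" "B \<inter> A = {i \<in> A. \<phi> i = 1}"
      by (rule shattersE[OF sh])
    then obtain x where x: "x \<in> X" "{i \<in> {1..n}. x i = 1} \<inter> A = {i \<in> A. \<phi> i = 1}"
      unfolding traces_def by blast
    have "x i = \<phi> i" if "i \<in> A" for i
    proof -
      have "x i = 1 \<longleftrightarrow> \<phi> i = 1" using x(2) that assms(2) by blast
      moreover have "x i \<in> {0, 1}"
        by (intro shift_space_value[OF X x(1)]) (use that assms(2) in auto)
      moreover have "\<phi> i \<in> {0, 1}" using \<phi> that by blast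
      ultimately show ?thesis by auto
    qed
    then show "\<exists>x\<in>X. \<forall>i\<in>A. x i = \<phi> i" using x(1) by blast
  qed
next
  assume ind: "independence_set X A"
  show "shatters (traces n X) A" unfolding shatters_alt
  proof (intro allI impI)
    fix C assume "C \<subseteq> A"
    have "(\<lambda>i. if i \<in> C then 1 else 0 :: nat) \<in> A \<rightarrow> {0, 1}" by (simp add: Pi_iff)
    from independence_setD[OF ind this]
    obtain x where "x \<in> X" "\<And>i. i \<in> A \<Longrightarrow> x i = (if i \<in> C then 1 else 0)" by blast
    then have "x i = 1 \<longleftrightarrow> i \<in> C" if "i \<in> A" for i using that by simp
    then have "{i \<in> {1..n}. x i = 1} \<inter> A = C" using \<open>C \<subseteq> A\<close> assms(2) by blast
    then show "\<exists>B\<in>traces n X. B \<inter> A = C" unfolding traces_def using \<open>x \<in> X\<close> by blast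
  qed
qed

text \<open>By hereditariness this is also the maximal number of elements in \<open>{1..n}\<close> of an
  arbitrary independence set.\<close>

definition max_indep :: "(nat \<Rightarrow> nat) set \<Rightarrow> nat \<Rightarrow> nat" where
  "max_indep X n = Max (card ` {A. A \<subseteq> {1..n} \<and> independence_set X A})"

lemma card_le_max_indep:
  assumes "independence_set X A"
  shows "card (A \<inter> {1..n}) \<le> max_indep X n"
  unfolding max_indep_def
  using independence_set_subset[OF assms, of "A \<inter> {1..n}"] by (intro Max_ge) auto

lemma max_indep_attained:
  assumes "X \<noteq> {}"
  obtains A where "A \<subseteq> {1..n}" "independence_set X A" "card A = max_indep X n"
proof -
  have "max_indep X n \<in> card ` {A. A \<subseteq> {1..n} \<and> independence_set X A}"
    unfolding max_indep_def using independence_set_empty[OF assms] by (intro Max_in) auto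
  then show ?thesis using that by auto
qed

text \<open>The part beyond \<open>m\<close> is moved back to start at 1, matching the shift of
  independence sets.\<close>

lemma card_Int_split:
  fixes A :: "nat set"
  shows "card (A \<inter> {1..m + n}) = card (A \<inter> {1..m}) + card ({i. i \<ge> 1 \<and> i + m \<in> A} \<inter> {1..n})"
proof -
  define B where "B = {i. i \<ge> 1 \<and> i + m \<in> A} \<inter> {1..n}"
  have "A \<inter> {1..m + n} = (A \<inter> {1..m}) \<union> (\<lambda>i. i + m) ` B"
  proof (intro equalityI subsetI)
    fix j assume j: "j \<in> A \<inter> {1..m + n}"
    show "j \<in> (A \<inter> {1..m}) \<union> (\<lambda>i. i + m) ` B"
    proof (cases "j \<le> m")
      case False
      then have "j = (j - m) + m" "j - m \<in> B" using j by (auto simp: B_def)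
      then show ?thesis by blast
    qed (use j in auto)
  qed (auto simp: B_def)
  moreover have "card ((A \<inter> {1..m}) \<union> (\<lambda>i. i + m) ` B)
      = card (A \<inter> {1..m}) + card ((\<lambda>i. i + m) ` B)"
    by (intro card_Un_disjoint) (auto simp: B_def)
  moreover have "card ((\<lambda>i. i + m) ` B) = card B" by (intro card_image) (auto simp: inj_on_def)
  ultimately show ?thesis by (simp add: B_def)
qed

lemma max_indep_add_le:
  assumes "shift_space X" "X \<noteq> {}"
  shows "max_indep X (m + n) \<le> max_indep X m + max_indep X n"
proof -
  obtain A where A: "A \<subseteq> {1..m + n}" "independence_set X A" "card A = max_indep X (m + n)"
    using max_indep_attained[OF assms(2)] by blast
  then have "card A = card (A \<inter> {1..m}) + card ({i. i \<ge> 1 \<and> i + m \<in> A} \<inter> {1..n})"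
    using card_Int_split[of A m n] by (simp add: Int_absorb2)
  also have "\<dots> \<le> max_indep X m + max_indep X n"
    using A(2) assms(1) by (intro add_mono card_le_max_indep independence_set_shift)
  finally show ?thesis using A(3) by simp
qed

section \<open>The maximal density of independence sets\<close>

text \<open>By Fekete's lemma this is also the limit of the ratios; the infimum gives a lower bound
  for \<open>max_indep\<close> at every length.\<close>

definition indep_density :: "(nat \<Rightarrow> nat) set \<Rightarrow> real" where
  "indep_density X = (INF n\<in>{1..}. real (max_indep X n) / n)"

lemma max_indep_tendsto:
  assumes "shift_space X" "X \<noteq> {}"
  shows "(\<lambda>n. real (max_indep X n) / n) \<longlonglongrightarrow> indep_density X"
  unfolding indep_density_def
  using max_indep_add_le[OF assms] by (intro fekete) (simp_all flip: of_nat_add)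

lemma indep_density_le: "n \<ge> 1 \<Longrightarrow> indep_density X \<le> real (max_indep X n) / n"
  unfolding indep_density_def by (rule fekete_le) simp_all

text \<open>There are at least as many independence sets in \<open>{1..n}\<close> as prefixes. All
  of them have at most \<open>max_indep X n\<close> elements, and exponentially many sets cannot all
  be too small.\<close>

lemma indep_density_pos:
  assumes "shift_space X" "X \<noteq> {}" "entropy X > 0"
  shows "indep_density X > 0"
proof -
  define h where "h = entropy X"
  \<comment> \<open>With \<open>t <= h / 2\<close>, the factor \<open>(1 + t) ^ n\<close> absorbs at
    most half of the exponential growth; the cap 1/2 keeps \<open>ln t\<close> negative.\<close>
  define t where "t = min (h / 2) (1 / 2)"
  have t: "0 < t" "t < 1" "t \<le> h / 2" using assms(3) by (auto simp: t_def h_def)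
  define c where "c = h / 2 / (- ln t)"
  have ln_t: "- ln t > 0" using t by simp
  have "c \<le> real (max_indep X n) / n" if n: "n \<ge> 1" for n
  proof -
    define m where "m = max_indep X n"
    define S where "S = {A. A \<subseteq> {1..n} \<and> shatters (traces n X) A}"
    have "card A \<le> m" if "A \<in> S" for A
      using that card_le_max_indep[of X A n] shatters_traces_iff[OF assms(1)]
      by (auto simp: S_def m_def Int_absorb2)
    then have "real (card S) * t ^ m \<le> (1 + t) ^ card {1..n}"
      using t by (intro card_small_subsets_le) (auto simp: S_def)
    moreover have "card (blocks n X) \<le> card S"
      unfolding S_def card_traces[OF assms(1), symmetric]
      by (rule card_le_card_shattered) (auto simp: traces_def)
    then have "real (card (blocks n X)) * t ^ m \<le> real (card S) * t ^ m"
      using t by (intro mult_right_mono) auto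
    ultimately have "real (card (blocks n X)) * t ^ m \<le> (1 + t) ^ n" by simp
    then have "ln (real (card (blocks n X)) * t ^ m) \<le> ln ((1 + t) ^ n)"
      using t card_blocks_pos[OF assms(1,2), of n] by (subst ln_le_cancel_iff) auto
    then have "ln (real (card (blocks n X))) + m * ln t \<le> n * ln (1 + t)"
      using t card_blocks_pos[OF assms(1,2), of n] by (simp add: ln_mult ln_realpow)
    moreover have "n * ln (1 + t) \<le> n * (h / 2)"
      using t ln_add_one_self_le_self[of t] by (intro mult_left_mono) auto
    moreover have "n * h \<le> ln (real (card (blocks n X)))"
      using entropy_le[OF assms(1,2) n] n by (simp add: h_def field_simps)
    ultimately have "n * (h / 2) \<le> m * (- ln t)" by simp
    then show ?thesis using ln_t n unfolding c_def m_def[symmetric]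
      by (simp add: divide_simps mult.commute)
  qed
  then have "c \<le> indep_density X"
    unfolding indep_density_def by (intro cINF_greatest) auto
  moreover have "c > 0" using assms(3) ln_t unfolding c_def h_def by (intro divide_pos_pos) auto
  ultimately show ?thesis by simp
qed

text \<open>If every independence set had a deficient initial segment of length at most \<open>N\<close>, one could
  cut an arbitrary one into deficient pieces, contradicting the lower bound on \<open>max_indep\<close>.\<close>

lemma finite_rich_independence_set:
  assumes X: "shift_space X" "X \<noteq> {}"
  shows "\<exists>A. independence_set X A \<and> (\<forall>n\<in>{1..N}. indep_density X * n \<le> card (A \<inter> {1..n}))"
proof (rule ccontr)
  assume neg: "\<not> ?thesis"
  define s where "s = indep_density X"
  \<comment> \<open>Only finitely many pairs of a length up to \<open>N\<close> and a deficient
    count exist, so their relative deficits have a positive minimum \<open>e\<close>. The extra 1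
    keeps \<open>E\<close> nonempty.\<close>
  define G where "G = {(n, c). n \<in> {1..N} \<and> c \<le> N \<and> real c < s * n}"
  define E where "E = insert 1 ((\<lambda>(n, c). (s * real n - real c) / n) ` G)"
  define e where "e = Min E"
  have "finite G" by (rule finite_subset[of _ "{1..N} \<times> {..N}"]) (auto simp: G_def)
  then have "finite E" by (simp add: E_def)
  then have e_pos: "e > 0" unfolding e_def
    by (subst Min_gr_iff) (auto simp: E_def G_def divide_simps)
  have deficient: "\<exists>n\<in>{1..N}. real (card (A \<inter> {1..n})) \<le> (s - e) * n"
    if "independence_set X A" for A
  proof -
    obtain n where n: "n \<in> {1..N}" "real (card (A \<inter> {1..n})) < s * n"
      using neg \<open>independence_set X A\<close> by (auto simp: not_le s_def)
    have "card (A \<inter> {1..n}) \<le> card {1..n}" by (intro card_mono) auto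
    then have "(n, card (A \<inter> {1..n})) \<in> G" using n by (auto simp: G_def)
    then have "(s * n - card (A \<inter> {1..n})) / n \<in> E" unfolding E_def by (intro insertI2) force
    then have "e \<le> (s * n - card (A \<inter> {1..n})) / n"
      unfolding e_def using \<open>finite E\<close> by simp
    then show ?thesis using n by (intro bexI[of _ n]) (auto simp: field_simps)
  qed
  \<comment> \<open>The empty set is an independence set with count 0, so the deficient bound cannot
    be negative.\<close>
  have "s - e \<ge> 0"
    using deficient[OF independence_set_empty[OF X(2)]] by (auto simp: zero_le_mult_iff)
  \<comment> \<open>Deficient pieces are cut off the front repeatedly; the last, incomplete piece
    has fewer than \<open>N\<close> elements and is covered by the summand \<open>N\<close>.\<close>
  have bound: "real (card (A \<inter> {1..L})) \<le> (s - e) * L + N" if "independence_set X A" for A L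
    using that
  proof (induction L arbitrary: A rule: less_induct)
    case (less L)
    obtain n where n: "n \<in> {1..N}" "real (card (A \<inter> {1..n})) \<le> (s - e) * n"
      using deficient[OF less.prems] by blast
    show ?case
    proof (cases "n \<le> L")
      case True
      define B where "B = {i. i \<ge> 1 \<and> i + n \<in> A}"
      have "card (A \<inter> {1..L}) = card (A \<inter> {1..n}) + card (B \<inter> {1..L - n})"
        using card_Int_split[of A n "L - n"] True by (simp add: B_def)
      moreover have "real (card (B \<inter> {1..L - n})) \<le> (s - e) * real (L - n) + N"
        using n True independence_set_shift[OF X(1) less.prems]
        by (intro less.IH) (auto simp: B_def)
      ultimately show ?thesis using n True by (simp add: of_nat_diff algebra_simps)
    next
      case False
      have "card (A \<inter> {1..L}) \<le> card {1..L}" by (intro card_mono) auto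
      then have "card (A \<inter> {1..L}) \<le> N" using n False by auto
      moreover have "0 \<le> (s - e) * L" using \<open>s - e \<ge> 0\<close> by simp
      ultimately show ?thesis by linarith
    qed
  qed
  \<comment> \<open>At this length the accumulated deficit \<open>L * e\<close> exceeds the error
    \<open>N\<close>.\<close>
  obtain L :: nat where "real N < L * e" using reals_Archimedean3[OF e_pos] by blast
  then have L: "L > 0" "real N < L * e" by (auto intro: gr0I)
  obtain A where A: "A \<subseteq> {1..L}" "independence_set X A" "card A = max_indep X L"
    using max_indep_attained[OF X(2)] by blast
  have "s * L \<le> max_indep X L"
    using indep_density_le[of L X] L by (simp add: s_def field_simps)
  also have "\<dots> \<le> (s - e) * L + N"
    using bound[OF A(2), of L] A by (simp add: Int_absorb2)
  finally show False using L by (simp add: algebra_simps)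
qed

lemma rich_independence_set:
  assumes X: "shift_space X" "X \<noteq> {}"
  obtains J where "independence_set X J" "\<And>n. n \<ge> 1 \<Longrightarrow> indep_density X \<le> count_ratio J n"
proof -
  obtain A where A: "\<And>N. independence_set X (A N)"
      "\<And>N n. n \<in> {1..N} \<Longrightarrow> indep_density X * n \<le> card (A N \<inter> {1..n})"
    using finite_rich_independence_set[OF X] by metis
  \<comment> \<open>A cluster point of the indicator functions of the sets \<open>A N\<close>
    defines \<open>J\<close>.\<close>
  from finite_valued_cluster_point[of "\<lambda>_. UNIV :: bool set" "\<lambda>N i. i \<in> A N"]
  obtain y where y: "\<And>N. \<exists>n\<ge>N. \<forall>i\<le>N. (i \<in> A n) = y i" by auto
  define J where "J = {i. i \<ge> 1 \<and> y i}"
  \<comment> \<open>The condition \<open>n >= N\<close> ensures that the density bounds known for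
    \<open>A n\<close> cover all lengths up to \<open>N\<close>.\<close>
  have J: "\<exists>n\<ge>N. J \<inter> {1..N} = A n \<inter> {1..N}" for N
    using y[of N] by (force simp: J_def)
  have "independence_set X J"
  proof (rule independence_set_if_initial_segments[OF X(1)])
    fix N
    obtain n where "J \<inter> {1..N} = A n \<inter> {1..N}" using J by blast
    then show "independence_set X (J \<inter> {1..N})"
      using independence_set_subset[OF A(1)[of n]] by simp
  qed (auto simp: J_def)
  moreover have "indep_density X \<le> count_ratio J n" if "n \<ge> 1" for n
  proof -
    obtain k where "k \<ge> n" "J \<inter> {1..n} = A k \<inter> {1..n}" using J by blast
    then show ?thesis using A(2)[of n k] that by (simp add: count_ratio_def field_simps)
  qed
  ultimately show ?thesis using that by blast
qed

section \<open>Shnirelman density as a lower bound for entropy\<close>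

lemma shnirelman_density_le: "n \<ge> 1 \<Longrightarrow> shnirelman_density A \<le> count_ratio A n"
  unfolding shnirelman_density_def
  by (intro cINF_lower bdd_belowI2[where m = 0]) (auto simp: count_ratio_def)

text \<open>The part of \<open>J\<close> in \<open>{1..n}\<close> is shattered by the prefixes, so
  its size bounds the binary logarithm of their number from below.\<close>

lemma shnirelman_density_le_entropy:
  assumes X: "shift_space X" "X \<noteq> {}" and J: "independence_set X J"
  shows "shnirelman_density J * ln 2 \<le> entropy X"
proof (rule LIMSEQ_le_const[OF entropy_tendsto[OF X]], intro exI allI impI)
  fix n :: nat assume n: "1 \<le> n"
  define A where "A = J \<inter> {1..n}"
  have "independence_set X A" unfolding A_def by (rule independence_set_subset[OF J]) auto
  then have "shatters (traces n X) A"
    using shatters_traces_iff[OF X(1), of A n] by (auto simp: A_def)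
  moreover have "finite (traces n X)"
    by (rule finite_subset[of _ "Pow {1..n}"]) (auto simp: traces_def)
  ultimately have "2 ^ card A \<le> card (traces n X)"
    by (rule two_power_le_card_if_shatters) (simp add: A_def)
  then have "2 ^ card A \<le> real (card (blocks n X))"
    unfolding card_traces[OF X(1)] using of_nat_le_iff by fastforce
  then have "ln (2 ^ card A) \<le> ln (real (card (blocks n X)))"
    using card_blocks_pos[OF X] by (subst ln_le_cancel_iff) auto
  then have "card A * ln 2 / n \<le> ln (real (card (blocks n X))) / n"
    by (intro divide_right_mono) (simp_all add: ln_realpow)
  moreover have "shnirelman_density J * ln 2 \<le> card A / n * ln 2"
    using shnirelman_density_le[OF n] by (intro mult_right_mono) (auto simp: count_ratio_def A_def)
  ultimately show "shnirelman_density J * ln 2 \<le> ln (real (card (blocks n X))) / n" by simp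
qed

theorem theorem1:
  fixes X :: "(nat \<Rightarrow> nat) set"
  assumes "shift_space X" and "X \<noteq> {}"
  shows "entropy X > 0 \<longleftrightarrow>
    (\<exists>J. independence_set X J \<and> has_asymptotic_density J \<and>
         asymptotic_density J = shnirelman_density J \<and> asymptotic_density J > 0)"
proof
  assume "entropy X > 0"
  then have pos: "indep_density X > 0" by (rule indep_density_pos[OF assms])
  obtain J where J: "independence_set X J" "\<And>n. n \<ge> 1 \<Longrightarrow> indep_density X \<le> count_ratio J n"
    using rich_independence_set[OF assms] by blast
  \<comment> \<open>The ratios of \<open>J\<close> lie between \<open>indep_density X\<close> and
    the ratios of \<open>max_indep\<close>, which converge to the same value.\<close>
  have lim: "count_ratio J \<longlonglongrightarrow> indep_density X"
  proof (rule tendsto_sandwich[OF _ _ tendsto_const max_indep_tendsto[OF assms]])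
    show "\<forall>\<^sub>F n in sequentially. indep_density X \<le> count_ratio J n"
      using J(2) by (rule eventually_sequentiallyI)
    show "\<forall>\<^sub>F n in sequentially. count_ratio J n \<le> real (max_indep X n) / n"
      unfolding count_ratio_def using card_le_max_indep[OF J(1)]
      by (intro always_eventually allI divide_right_mono) simp_all
  qed
  have "shnirelman_density J \<le> indep_density X"
    by (rule LIMSEQ_le_const[OF lim]) (intro exI[of _ 1] allI impI shnirelman_density_le)
  moreover have "indep_density X \<le> shnirelman_density J"
    unfolding shnirelman_density_def using J(2) by (intro cINF_greatest) auto
  moreover have "asymptotic_density J = indep_density X"
    unfolding asymptotic_density_def by (rule limI[OF lim])
  moreover have "has_asymptotic_density J"
    unfolding has_asymptotic_density_def using lim by (rule convergentI)
  ultimately show "\<exists>J. independence_set X J \<and> has_asymptotic_density J \<and>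
         asymptotic_density J = shnirelman_density J \<and> asymptotic_density J > 0"
    using J(1) pos by (intro exI[of _ J] conjI) simp_all
next
  assume "\<exists>J. independence_set X J \<and> has_asymptotic_density J \<and>
         asymptotic_density J = shnirelman_density J \<and> asymptotic_density J > 0"
  \<comment> \<open>Equality of the two densities carries positivity over to the Shnirelman
    density.\<close>
  then obtain J where J: "independence_set X J" "shnirelman_density J > 0" by metis
  then have "0 < shnirelman_density J * ln 2" by simp
  also have "\<dots> \<le> entropy X" by (rule shnirelman_density_le_entropy[OF assms J(1)])
  finally show "entropy X > 0" .
qed

end
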